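(* Let $k\ge 1$ be an integer. If $T$ is a tree of order $n \neq k$, then $\zeta_k(T) \leq \zeta_k^i(T) \leq \frac{n}{k+1}$.
   Context: Graphs are finite and simple; the order of a graph is its number of vertices. For a graph $G$ and $S\subseteq V(G)$, $N[S]$ denotes the closed neighborhood of $S$, i.e. $S$ together with all vertices adjacent to a vertex of $S$. A set $S\subseteq V(G)$ (possibly empty) is an all-$k$-isolating set of $G$ if $G-N[S]$ has no component of order at least $k$. The all-$k$-isolation number $\zeta_k(G)$ is the minimum size of an all-$k$-isolating set of $G$. The number $\zeta_k^i(G)$ is the minimum size of an all-$k$-isolating set of $G$ that is also an independent set. *)

theory Defs
  imports Complex_Main "Graph_Theory.Digraph_Component"
begin

text \<open>
  Finite simple graphs are modelled by the locale \<^locale>\<open>graph\<close>: an undirected edge is a pair of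
  opposite arcs. Since the arcs are symmetric, the strongly connected components
  (\<^const>\<open>pre_digraph.sccs\<close>) of such a graph and of its induced subgraphs are their ordinary
  components.
\<close>

definition closed_nbhd :: "('a, 'b) pre_digraph \<Rightarrow> 'a set \<Rightarrow> 'a set" where
  "closed_nbhd G S = S \<union> {v \<in> verts G. \<exists>u \<in> S. u \<rightarrow>\<^bsub>G\<^esub> v}"

definition all_isolating :: "nat \<Rightarrow> ('a, 'b) pre_digraph \<Rightarrow> 'a set \<Rightarrow> bool" where
  "all_isolating k G S \<longleftrightarrow> S \<subseteq> verts G \<and>
     \<not> (\<exists>H \<in> pre_digraph.sccs (G \<restriction> (verts G - closed_nbhd G S)). k \<le> card (verts H))"

definition independent_set :: "('a, 'b) pre_digraph \<Rightarrow> 'a set \<Rightarrow> bool" where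
  "independent_set G S \<longleftrightarrow> S \<subseteq> verts G \<and> (\<forall>u \<in> S. \<forall>v \<in> S. \<not> u \<rightarrow>\<^bsub>G\<^esub> v)"

definition all_isolation_number :: "nat \<Rightarrow> ('a, 'b) pre_digraph \<Rightarrow> nat" where
  "all_isolation_number k G = (LEAST m. \<exists>S. all_isolating k G S \<and> card S = m)"

definition indep_all_isolation_number :: "nat \<Rightarrow> ('a, 'b) pre_digraph \<Rightarrow> nat" where
  "indep_all_isolation_number k G =
     (LEAST m. \<exists>S. all_isolating k G S \<and> independent_set G S \<and> card S = m)"

text \<open>
  The predicates \<^const>\<open>forest\<close> and \<^const>\<open>tree\<close> of the library count the closed walk
  \<open>u, v, u\<close> along an edge and back as a cycle, so no symmetric digraph with an edge satisfies them.
  A cycle of an undirected simple graph has length at least three. Connectedness includes that there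
  is a vertex.
\<close>

definition undirected_tree :: "('a, 'b) pre_digraph \<Rightarrow> bool" where
  "undirected_tree G \<longleftrightarrow> graph G \<and> connected G \<and>
     \<not> (\<exists>p. pre_digraph.cycle G p \<and> 3 \<le> length p)"

text \<open>
  Both minima range over nonempty sets: a maximal independent set \<open>S\<close> is dominating, so nothing is
  left after removing its closed neighbourhood.
\<close>

lemma all_isolating_if_dominating:
  assumes "S \<subseteq> verts G" "verts G \<subseteq> closed_nbhd G S"
  shows "all_isolating k G S"
proof -
  have "verts H = {}" if "induced_subgraph H (G \<restriction> (verts G - closed_nbhd G S))" for H
    using that assms(2) by (auto simp: induced_subgraph_def subgraph_def induce_subgraph_def)
  then show ?thesis
    using assms(1)
    by (fastforce simp: all_isolating_def pre_digraph.sccs_def strongly_connected_def)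
qed

lemma ex_independent_all_isolating:
  assumes "graph G"
  shows "\<exists>S. all_isolating k G S \<and> independent_set G S"
proof -
  interpret graph G by fact
  let ?I = "{S. independent_set G S}"
  have "finite ?I"
    by (rule finite_subset[of _ "Pow (verts G)"]) (auto simp: independent_set_def)
  moreover have "{} \<in> ?I" by (simp add: independent_set_def)
  ultimately obtain S where S: "independent_set G S"
    and max: "\<And>S'. independent_set G S' \<Longrightarrow> S \<subseteq> S' \<Longrightarrow> S = S'"
    using finite_has_maximal[of ?I] by auto
  have "verts G \<subseteq> closed_nbhd G S"
  proof
    fix v assume v: "v \<in> verts G"
    show "v \<in> closed_nbhd G S"
    proof (rule ccontr)
      assume nv: "v \<notin> closed_nbhd G S"
      have "\<not> v \<rightarrow>\<^bsub>G\<^esub> v" using no_loops by (auto simp: arcs_ends_conv)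
      with S v nv have "independent_set G (insert v S)"
        by (auto simp: independent_set_def closed_nbhd_def dest: graph_symmetric)
      from max[OF this] nv show False by (auto simp: closed_nbhd_def)
    qed
  qed
  with S show ?thesis
    using all_isolating_if_dominating[of S G k] by (auto simp: independent_set_def)
qed

end

theory Submission
  imports Defs
begin

text \<open>
  If the order \<open>n\<close> is below \<open>k\<close>, the empty set isolates. As \<open>n \<noteq> k\<close>, let \<open>n \<ge> k + 1\<close>. Without independence the
  bound comes from a greedy cut: in a rooted tree take a deepest vertex \<open>v\<close> whose subtree has more than
  \<open>k\<close> vertices, put \<open>v\<close> into the set and cut its subtree off. Each step pays one vertex for at least
  \<open>k + 1\<close>, the subtrees below \<open>v\<close> have at most \<open>k\<close> vertices, and each of them loses its top vertex to
  the neighbourhood of \<open>v\<close>. A last remainder of at most \<open>k\<close> vertices joins the piece of a neighbouring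
  \<open>v\<close>. The vertices \<open>v\<close> chosen in this way are called centres here (\<open>ex_centred\<close>).

  The centres may be adjacent, so only an independent set \<open>X\<close> of them is kept, chosen so that every
  centre is in \<open>X\<close> or adjacent to \<open>X\<close>. Removing the closed neighbourhood of \<open>X\<close> then still removes all
  centres, and what is left lies inside the pieces between them. A piece violates the isolation only if
  it has exactly \<open>k\<close> vertices and has no neighbour in \<open>X\<close>; adding any single vertex of it to the set
  repairs this and keeps independence. If \<open>m\<^sub>z\<close> of the pieces assigned to the centre \<open>z\<close> have exactly
  \<open>k\<close> vertices, the price is thus \<open>1\<close> for \<open>z\<close> in \<open>X\<close> and at most \<open>m\<^sub>z\<close> for \<open>z\<close> outside \<open>X\<close>.

  A tree is bipartite. Let \<open>X\<close> consist of the centres without adjacent centres and of one colour class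
  of all the others. Both colour classes are possible, and the prices of the two choices add up to
  \<open>1 + m\<^sub>z\<close> for each of the other centres, so the cheaper one pays at most \<open>(1 + m\<^sub>z) / 2\<close> for each on
  average (\<open>ex_cheap_independent_dominating\<close>). On the other hand \<open>z\<close> together with its pieces has at
  least \<open>k + 1\<close> and at least \<open>1 + m\<^sub>z k\<close> vertices, which is enough to pay both \<open>1\<close> and \<open>(1 + m\<^sub>z) / 2\<close>
  at the rate of \<open>k + 1\<close> vertices each (\<open>weight_bound\<close>).
\<close>

section \<open>Rooted trees given by a parent function\<close>

locale rooted_tree =
  fixes V :: "'a set" and r :: 'a and par :: "'a \<Rightarrow> 'a" and depth :: "'a \<Rightarrow> nat"
  assumes finite_V: "finite V"
    and root_in: "r \<in> V"
    and par_in: "\<And>x. x \<in> V \<Longrightarrow> x \<noteq> r \<Longrightarrow> par x \<in> V"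
    and depth_par: "\<And>x. x \<in> V \<Longrightarrow> x \<noteq> r \<Longrightarrow> depth x = Suc (depth (par x))"
begin

definition up :: "('a \<times> 'a) set" where
  "up = {(x, y). x \<in> V \<and> x \<noteq> r \<and> y = par x}"

definition adj :: "'a \<Rightarrow> 'a \<Rightarrow> bool" where
  "adj x y \<longleftrightarrow> (x, y) \<in> up \<or> (y, x) \<in> up"

definition desc :: "'a \<Rightarrow> 'a set" where
  "desc v = {x. (x, v) \<in> up\<^sup>*}"

definition separated :: "'a set \<Rightarrow> 'a set \<Rightarrow> bool" where
  "separated A B \<longleftrightarrow> A \<inter> B = {} \<and> (\<forall>x\<in>A. \<forall>y\<in>B. \<not> adj x y)"

definition up_closed :: "'a set \<Rightarrow> bool" where
  "up_closed U \<longleftrightarrow> U \<subseteq> V \<and> r \<in> U \<and> (\<forall>x\<in>U. x \<noteq> r \<longrightarrow> par x \<in> U)"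

lemma adj_sym: "adj x y \<longleftrightarrow> adj y x"
  by (auto simp: adj_def)

lemma adj_odd_depth: "adj x y \<Longrightarrow> odd (depth x) \<longleftrightarrow> even (depth y)"
  using depth_par by (auto simp: adj_def up_def)

lemma separated_sym: "separated A B \<Longrightarrow> separated B A"
  unfolding separated_def using adj_sym by blast

lemma card_Union_separated:
  assumes "\<And>A. A \<in> \<C> \<Longrightarrow> finite A" "\<forall>A\<in>\<C>. \<forall>B\<in>\<C>. A \<noteq> B \<longrightarrow> separated A B"
  shows "card (\<Union>\<C>) = (\<Sum>A\<in>\<C>. card A)"
  using assms by (intro card_Union_disjoint) (auto simp: pairwise_def disjnt_def separated_def)

lemma desc_self [simp]: "v \<in> desc v"
  by (simp add: desc_def)

lemma desc_trans: "x \<in> desc u \<Longrightarrow> u \<in> desc v \<Longrightarrow> x \<in> desc v"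
  by (auto simp: desc_def)

lemma child_in_desc: "(x, y) \<in> up \<Longrightarrow> y \<in> desc v \<Longrightarrow> x \<in> desc v"
  unfolding desc_def by (auto intro: converse_rtrancl_into_rtrancl)

lemma par_in_desc: "(x, y) \<in> up \<Longrightarrow> x \<in> desc v \<Longrightarrow> x \<noteq> v \<Longrightarrow> y \<in> desc v"
  unfolding desc_def by (auto elim: converse_rtranclE simp: up_def)

lemma depth_desc:
  assumes "x \<in> desc v" shows "x = v \<or> depth v < depth x"
proof -
  have "(x, v) \<in> up\<^sup>*" using assms by (simp add: desc_def)
  then show ?thesis
    by (induction rule: converse_rtrancl_induct) (use depth_par in \<open>auto simp: up_def\<close>)
qed

lemma root_in_desc: "r \<in> desc v \<Longrightarrow> v = r"
  unfolding desc_def by (auto elim: converse_rtranclE simp: up_def)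

lemma desc_root: "x \<in> V \<Longrightarrow> x \<in> desc r"
proof (induction "depth x" arbitrary: x rule: less_induct)
  case less
  show ?case
  proof (cases "x = r")
    case False
    then have "(x, par x) \<in> up" using less.prems by (simp add: up_def)
    moreover have "par x \<in> desc r"
      using less False par_in depth_par by simp
    ultimately show ?thesis by (rule child_in_desc)
  qed simp
qed

lemma children_desc_disjoint:
  assumes "(u, v) \<in> up" "(u', v) \<in> up" "x \<in> desc u" "x \<in> desc u'"
  shows "u = u'"
proof -
  have "single_valued up" by (auto simp: single_valued_def up_def)
  then have "u \<in> desc u' \<or> u' \<in> desc u"
    using assms(3,4) single_valued_confluent unfolding desc_def by fastforce
  moreover have "depth u = depth u'"
    using assms(1,2) depth_par by (auto simp: up_def)
  ultimately show ?thesis using depth_desc by fastforce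
qed

lemma up_closed_finite: "up_closed U \<Longrightarrow> finite U"
  using finite_V finite_subset by (auto simp: up_closed_def)

section \<open>Cutting the tree at centres\<close>

text \<open>
  A greedy cut at a deepest vertex \<open>v\<close> with more than \<open>k\<close> descendants in \<open>U\<close>, itself included. The members of \<open>\<D>\<close> are
  the subtrees below the children of \<open>v\<close>; maximal depth of \<open>v\<close> is what makes them small.
\<close>

lemma cut_subtree:
  assumes U: "up_closed U" and large: "k < card U"
  obtains v \<D> where "v \<in> U" "finite \<D>" "\<Union>\<D> = U \<inter> desc v - {v}"
    "\<forall>A\<in>\<D>. card A \<le> k \<and> (\<exists>x\<in>A. adj v x) \<and> separated A (U - desc v)"
    "\<forall>A\<in>\<D>. \<forall>B\<in>\<D>. A \<noteq> B \<longrightarrow> separated A B"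
    "k \<le> (\<Sum>A\<in>\<D>. card A)"
proof -
  have fU: "finite U" using U by (rule up_closed_finite)
  define W where "W = {v\<in>U. k < card (U \<inter> desc v)}"
  have "U \<inter> desc r = U" using U desc_root by (auto simp: up_closed_def)
  with U large have "r \<in> W" by (simp add: W_def up_closed_def)
  moreover have "finite W" using fU by (simp add: W_def)
  ultimately have "Max (depth ` W) \<in> depth ` W" by (intro Max_in) auto
  then obtain v where v: "v \<in> W" and "depth v = Max (depth ` W)" by auto
  then have deepest: "depth w \<le> depth v" if "w \<in> W" for w
    using that \<open>finite W\<close> by simp
  define K where "K = {u\<in>U. (u, v) \<in> up}"
  define \<D> where "\<D> = (\<lambda>u. U \<inter> desc u) ` K"
  have vU: "v \<in> U" using v by (simp add: W_def)
  have K_desc: "u \<in> desc v" if "u \<in> K" for u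
    using that child_in_desc[of u v v] by (simp add: K_def)
  have v_notin: "v \<notin> desc u" if "u \<in> K" for u
    using depth_desc[of v u] depth_par[of u] that by (auto simp: K_def up_def)
  have cover: "\<Union>\<D> = U \<inter> desc v - {v}"
  proof
    show "\<Union>\<D> \<subseteq> U \<inter> desc v - {v}"
      using K_desc v_notin desc_trans by (auto simp: \<D>_def)
    show "U \<inter> desc v - {v} \<subseteq> \<Union>\<D>"
    proof
      fix x assume x: "x \<in> U \<inter> desc v - {v}"
      then have "(x, v) \<in> up\<^sup>*" "x \<noteq> v" by (auto simp: desc_def)
      then obtain u where u: "(x, u) \<in> up\<^sup>*" "(u, v) \<in> up"
        by (metis rtranclE)
      from u(1) have "x \<in> U \<longrightarrow> u \<in> U"
        by (induction rule: converse_rtrancl_induct) (use U in \<open>auto simp: up_closed_def up_def\<close>)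
      with x u show "x \<in> \<Union>\<D>" by (auto simp: \<D>_def K_def desc_def)
    qed
  qed
  have disj: "U \<inter> desc u \<inter> (U \<inter> desc u') = {}" if "u \<in> K" "u' \<in> K" "u \<noteq> u'" for u u'
    using that children_desc_disjoint by (auto simp: K_def)
  \<comment> \<open>The only edge leaving the subtree of a child of \<open>v\<close> ends in \<open>v\<close>.\<close>
  have leave: "y \<in> desc u \<or> y = v" if "u \<in> K" "x \<in> desc u" "adj x y" for u x y
  proof (cases "(y, x) \<in> up")
    case True then show ?thesis using that child_in_desc by blast
  next
    case False
    then have xy: "(x, y) \<in> up" using that by (auto simp: adj_def)
    show ?thesis
    proof (cases "x = u")
      case True then show ?thesis using xy that by (auto simp: K_def up_def)
    next
      case False then show ?thesis using xy that par_in_desc by blast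
    qed
  qed
  have sep: "separated A B" if "A \<in> \<D>" "B \<in> \<D>" "A \<noteq> B" for A B
  proof -
    from that obtain u u' where u: "u \<in> K" "u' \<in> K" "A = U \<inter> desc u" "B = U \<inter> desc u'"
      by (auto simp: \<D>_def)
    with that have "A \<inter> B = {}" using disj by blast
    moreover have "\<not> adj x y" if "x \<in> A" "y \<in> B" for x y
      using leave[of u x y] v_notin[of u'] u that \<open>A \<inter> B = {}\<close> by blast
    ultimately show ?thesis by (auto simp: separated_def)
  qed
  have sep_rest: "separated A (U - desc v)" if A: "A \<in> \<D>" for A
  proof -
    from A obtain u where u: "u \<in> K" "A = U \<inter> desc u" by (auto simp: \<D>_def)
    then have "desc u \<subseteq> desc v" using K_desc desc_trans by blast
    then show ?thesis using leave[OF u(1)] u(2) by (fastforce simp: separated_def)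
  qed
  have small: "card A \<le> k" if A: "A \<in> \<D>" for A
  proof -
    from A obtain u where u: "u \<in> K" "A = U \<inter> desc u" by (auto simp: \<D>_def)
    then have "depth v < depth u" using depth_par by (auto simp: K_def up_def)
    then have "u \<notin> W" using deepest[of u] by auto
    then show ?thesis using u by (auto simp: W_def K_def)
  qed
  have touch: "\<exists>x\<in>A. adj v x" if "A \<in> \<D>" for A
  proof -
    from that obtain u where u: "u \<in> K" "A = U \<inter> desc u" by (auto simp: \<D>_def)
    then show ?thesis by (intro bexI[of _ u]) (auto simp: K_def adj_def)
  qed
  have fD: "finite \<D>" using fU by (simp add: \<D>_def K_def)
  have "finite A" if "A \<in> \<D>" for A
    using that fU by (auto simp: \<D>_def)
  then have "(\<Sum>A\<in>\<D>. card A) = card (\<Union>\<D>)"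
    using sep card_Union_separated[of \<D>] by simp
  also have "\<dots> = card (U \<inter> desc v) - 1"
    using cover vU by simp
  finally have "(\<Sum>A\<in>\<D>. card A) = card (U \<inter> desc v) - 1" .
  moreover have "k < card (U \<inter> desc v)" using v by (simp add: W_def)
  ultimately have "k \<le> (\<Sum>A\<in>\<D>. card A)" by linarith
  with that[of v \<D>] vU fD cover small touch sep sep_rest show ?thesis by blast
qed

text \<open>
  The set \<open>Z\<close> collects the centres of the cuts and \<open>\<C>\<close> the pieces of \<open>U - Z\<close>. A piece may be adjacent to
  several centres; \<open>\<phi>\<close> charges it to one of them, so that every centre is charged at least \<open>k\<close> vertices.
\<close>

definition centred :: "nat \<Rightarrow> 'a set \<Rightarrow> 'a set \<Rightarrow> 'a set set \<Rightarrow> ('a set \<Rightarrow> 'a) \<Rightarrow> bool" where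
  "centred k U Z \<C> \<phi> \<longleftrightarrow> Z \<subseteq> U \<and> finite \<C> \<and> \<Union>\<C> = U - Z
     \<and> (\<forall>A\<in>\<C>. \<forall>B\<in>\<C>. A \<noteq> B \<longrightarrow> separated A B)
     \<and> (\<forall>A\<in>\<C>. card A \<le> k \<and> \<phi> A \<in> Z \<and> (\<exists>x\<in>A. adj (\<phi> A) x))
     \<and> (\<forall>z\<in>Z. k \<le> (\<Sum>A | A \<in> \<C> \<and> \<phi> A = z. card A))"

text \<open>
  Induction along the greedy cuts. What remains after a cut contains the root and is closed under
  parents, so it is again a tree of the same kind. Once it has at most \<open>k\<close> vertices it becomes one more
  piece, charged to the last centre, whose parent it contains.
\<close>

lemma ex_centred:
  assumes "up_closed U" "k < card U"
  shows "\<exists>Z \<C> \<phi>. centred k U Z \<C> \<phi>"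
  using assms
proof (induction "card U" arbitrary: U rule: less_induct)
  case less
  from less.prems obtain v \<D> where v: "v \<in> U" and fD: "finite \<D>"
    and cover: "\<Union>\<D> = U \<inter> desc v - {v}"
    and pieces: "\<forall>A\<in>\<D>. card A \<le> k \<and> (\<exists>x\<in>A. adj v x) \<and> separated A (U - desc v)"
    and separate: "\<forall>A\<in>\<D>. \<forall>B\<in>\<D>. A \<noteq> B \<longrightarrow> separated A B"
    and weight: "k \<le> (\<Sum>A\<in>\<D>. card A)"
    by (rule cut_subtree)
  have small: "card A \<le> k" and touch: "\<exists>x\<in>A. adj v x"
    and sep_rest: "separated A (U - desc v)" if "A \<in> \<D>" for A
    using pieces that by auto
  have sep: "separated A B" if "A \<in> \<D>" "B \<in> \<D>" "A \<noteq> B" for A B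
    using separate that by auto
  define R where "R = U - desc v"
  have fU: "finite U" using less.prems(1) by (rule up_closed_finite)
  have UV: "U \<subseteq> V" "r \<in> U" and U_par: "\<And>x. x \<in> U \<Longrightarrow> x \<noteq> r \<Longrightarrow> par x \<in> U"
    using less.prems(1) by (auto simp: up_closed_def)
  have v_root: "v \<noteq> r" if "R \<noteq> {}"
    using that UV desc_root by (fastforce simp: R_def)
  show ?case
  proof (cases "k < card R")
    case True
    then have "v \<noteq> r" using v_root by force
    have "up_closed R"
      using UV U_par \<open>v \<noteq> r\<close> root_in_desc child_in_desc
      by (auto simp: up_closed_def R_def up_def)
    moreover have "card R < card U"
      using v fU desc_self[of v] unfolding R_def by (intro psubset_card_mono) blast+
    ultimately obtain Z \<C> \<phi> where IH: "centred k R Z \<C> \<phi>"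
      using less.hyps True by blast
    define \<psi> where "\<psi> A = (if A \<in> \<C> then \<phi> A else v)" for A
    \<comment> \<open>The new pieces are nonempty and lie outside \<open>R\<close>, so \<open>\<psi>\<close> does not change the old charges.\<close>
    have new: "A \<notin> \<C>" if "A \<in> \<D>" for A
      using that cover touch[OF that] IH by (auto simp: centred_def R_def)
    have vZ: "v \<notin> Z" using IH by (auto simp: centred_def R_def)
    have cross: "separated A B" if "A \<in> \<D>" "B \<in> \<C>" for A B
    proof -
      have "B \<subseteq> U - desc v" using that(2) IH by (auto simp: centred_def R_def)
      then show ?thesis using sep_rest[OF that(1)] by (auto simp: separated_def)
    qed
    have "{A \<in> \<D> \<union> \<C>. \<psi> A = v} = \<D>"
      using new vZ IH by (auto simp: \<psi>_def centred_def)
    moreover have "{A \<in> \<D> \<union> \<C>. \<psi> A = z} = {A \<in> \<C>. \<phi> A = z}" if "z \<in> Z" for z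
      using new vZ that by (auto simp: \<psi>_def)
    ultimately have "\<forall>z\<in>insert v Z. k \<le> (\<Sum>A | A \<in> \<D> \<union> \<C> \<and> \<psi> A = z. card A)"
      using weight IH by (simp add: centred_def)
    moreover have "\<Union>(\<D> \<union> \<C>) = U - insert v Z"
      using cover IH v by (auto simp: centred_def R_def)
    moreover have "\<forall>A\<in>\<D> \<union> \<C>. \<forall>B\<in>\<D> \<union> \<C>. A \<noteq> B \<longrightarrow> separated A B"
      using sep cross separated_sym IH by (auto simp: centred_def)
    moreover have "\<forall>A\<in>\<D> \<union> \<C>. card A \<le> k \<and> \<psi> A \<in> insert v Z \<and> (\<exists>x\<in>A. adj (\<psi> A) x)"
      using small touch new IH by (auto simp: centred_def \<psi>_def)
    ultimately have "centred k U (insert v Z) (\<D> \<union> \<C>) \<psi>"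
      using v fD IH by (auto simp: centred_def R_def)
    then show ?thesis by blast
  next
    case False
    \<comment> \<open>If \<open>v\<close> is the root, then \<open>R\<close> is empty and touches no centre, so it must not count as a piece.\<close>
    define \<C> where "\<C> = \<D> \<union> ({R} - {{}})"
    have "\<exists>x\<in>R. adj v x" if "R \<noteq> {}"
    proof -
      have "v \<noteq> r" using that by (rule v_root)
      then have up: "(v, par v) \<in> up" using v UV by (auto simp: up_def)
      then have "par v \<notin> desc v"
        using depth_desc[of "par v" v] depth_par[of v] by (auto simp: up_def)
      then show ?thesis using up U_par[OF v \<open>v \<noteq> r\<close>] by (auto simp: R_def adj_def)
    qed
    then have "\<forall>A\<in>\<C>. card A \<le> k \<and> v \<in> {v} \<and> (\<exists>x\<in>A. adj v x)"
      using small touch False by (auto simp: \<C>_def)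
    moreover have "k \<le> (\<Sum>A\<in>\<C>. card A)"
      using fD by (intro le_trans[OF weight] sum_mono2) (auto simp: \<C>_def)
    moreover have "finite \<C>" using fD by (simp add: \<C>_def)
    moreover have "\<Union>\<C> = U - {v}"
    proof -
      have "\<Union>\<C> = \<Union>\<D> \<union> R" by (auto simp: \<C>_def)
      then show ?thesis using cover desc_self[of v] unfolding R_def by blast
    qed
    moreover have "\<forall>A\<in>\<C>. \<forall>B\<in>\<C>. A \<noteq> B \<longrightarrow> separated A B"
    proof (intro ballI impI)
      fix A B assume "A \<in> \<C>" "B \<in> \<C>" "A \<noteq> B"
      then consider "A \<in> \<D>" "B \<in> \<D>" | "A \<in> \<D>" "B = R" | "A = R" "B \<in> \<D>"
        by (auto simp: \<C>_def)
      then show "separated A B"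
        using \<open>A \<noteq> B\<close> sep sep_rest separated_sym by cases (simp_all add: R_def)
    qed
    ultimately have "centred k U {v} \<C> (\<lambda>_. v)"
      using v by (simp add: centred_def)
    then show ?thesis by blast
  qed
qed

section \<open>Choosing among the centres\<close>

text \<open>
  The parity of the depth is a proper two-colouring. A centre that has adjacent centres sees only those of
  the opposite colour, so either colour class of such centres dominates the other, and the two choices
  together cost \<open>1 + m z\<close> for each \<open>z\<close>. Isolated centres have to be taken anyway; they
  account for the \<open>2\<close> in the maximum.
\<close>

lemma ex_cheap_independent_dominating:
  fixes m :: "'a \<Rightarrow> nat"
  assumes "finite Z"
  shows "\<exists>X\<subseteq>Z. (\<forall>x\<in>X. \<forall>y\<in>X. \<not> adj x y) \<and> (\<forall>z\<in>Z - X. \<exists>x\<in>X. adj x z)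
    \<and> 2 * (card X + (\<Sum>z\<in>Z - X. m z)) \<le> (\<Sum>z\<in>Z. max 2 (1 + m z))"
proof -
  define I where "I = {z\<in>Z. \<forall>y\<in>Z. \<not> adj z y}"
  define N where "N b = {z\<in>Z - I. even (depth z) = b}" for b
  define cost where "cost b = card (N b) + (\<Sum>z\<in>N (\<not> b). m z)" for b
  have fin: "finite I" "finite (N b)" for b using assms by (auto simp: I_def N_def)
  have split: "sum f Z = sum f I + (sum f (N b) + sum f (N (\<not> b)))" for f :: "'a \<Rightarrow> nat" and b
  proof -
    have "Z = I \<union> (N b \<union> N (\<not> b))" by (auto simp: I_def N_def)
    moreover have "I \<inter> (N b \<union> N (\<not> b)) = {}" "N b \<inter> N (\<not> b) = {}" by (auto simp: N_def)
    ultimately show ?thesis using fin by (simp add: sum.union_disjoint)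
  qed
  obtain b where b: "cost b \<le> cost (\<not> b)" using that[of True] that[of False] by fastforce
  define X where "X = I \<union> N b"
  have rest: "Z - X = N (\<not> b)" by (auto simp: X_def I_def N_def)
  have indep: "\<not> adj x y" if "x \<in> X" "y \<in> X" for x y
  proof
    assume xy: "adj x y"
    have "x \<notin> I" "y \<notin> I" using that xy adj_sym by (auto simp: X_def I_def N_def)
    then have "even (depth x) = even (depth y)" using that by (auto simp: X_def N_def)
    then show False using adj_odd_depth[OF xy] by auto
  qed
  have dom: "\<exists>x\<in>X. adj x z" if z: "z \<in> Z - X" for z
  proof -
    have "z \<in> N (\<not> b)" using z rest by simp
    then obtain y where y: "y \<in> Z" "adj z y" by (auto simp: N_def I_def)
    then have "y \<notin> I" using \<open>z \<in> N (\<not> b)\<close> adj_sym by (auto simp: I_def N_def)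
    then have "y \<in> N b"
      using y \<open>z \<in> N (\<not> b)\<close> adj_odd_depth[OF y(2)] by (auto simp: N_def)
    then show ?thesis using y adj_sym by (auto simp: X_def)
  qed
  have "2 * (card X + (\<Sum>z\<in>Z - X. m z)) = 2 * card I + 2 * cost b"
    using fin rest by (simp add: X_def cost_def card_Un_disjoint N_def Int_def)
  also have "\<dots> \<le> 2 * card I + (cost b + cost (\<not> b))" using b by simp
  also have "\<dots> = (\<Sum>z\<in>I. 2) + ((\<Sum>z\<in>N b. 1 + m z) + (\<Sum>z\<in>N (\<not> b). 1 + m z))"
    by (simp add: cost_def sum.distrib sum_Suc)
  also have "\<dots> \<le> (\<Sum>z\<in>I. max 2 (1 + m z))
      + ((\<Sum>z\<in>N b. max 2 (1 + m z)) + (\<Sum>z\<in>N (\<not> b). max 2 (1 + m z)))"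
    by (intro add_mono sum_mono) auto
  also have "\<dots> = (\<Sum>z\<in>Z. max 2 (1 + m z))" using split[of "\<lambda>z. max 2 (1 + m z)" b] by simp
  finally have "2 * (card X + (\<Sum>z\<in>Z - X. m z)) \<le> (\<Sum>z\<in>Z. max 2 (1 + m z))" .
  moreover have "X \<subseteq> Z" by (auto simp: X_def I_def N_def)
  ultimately show ?thesis using indep dom by (intro exI[of _ X] conjI ballI)
qed

definition connected_set :: "'a set \<Rightarrow> bool" where
  "connected_set H \<longleftrightarrow> (\<forall>x\<in>H. \<forall>y\<in>H. (x, y) \<in> {(a, b). adj a b \<and> a \<in> H \<and> b \<in> H}\<^sup>*)"

lemma connected_set_in_piece:
  assumes "connected_set H" "H \<noteq> {}" "H \<subseteq> \<Union>\<C>"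
    and sep: "\<And>A B. A \<in> \<C> \<Longrightarrow> B \<in> \<C> \<Longrightarrow> A \<noteq> B \<Longrightarrow> separated A B"
  shows "\<exists>A\<in>\<C>. H \<subseteq> A"
proof -
  obtain x A where x: "x \<in> H" "x \<in> A" "A \<in> \<C>" using assms(2,3) by blast
  have "y \<in> A" if "y \<in> H" for y
  proof -
    have "(x, y) \<in> {(a, b). adj a b \<and> a \<in> H \<and> b \<in> H}\<^sup>*"
      using assms(1) x(1) that by (simp add: connected_set_def)
    then show "y \<in> A"
    proof (induction rule: rtrancl_induct)
      case (step y z)
      then obtain B where "z \<in> B" "B \<in> \<C>" using assms(3) by blast
      with step sep[of A B] x show ?case by (auto simp: separated_def)
    qed (use x in simp)
  qed
  with x show ?thesis by blast
qed

end

text \<open>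
  The exchange rate between vertices and chosen vertices: a centre charged with \<open>s\<close> vertices in its pieces,
  \<open>m\<close> of which have size \<open>k\<close>, can afford its share of the cost. The bound \<open>k \<le> s\<close> settles \<open>m \<le> 1\<close>, and
  for larger \<open>m\<close> the pieces of size \<open>k\<close> alone weigh enough, since \<open>k - 1 \<le> m * (k - 1)\<close>.
\<close>

lemma weight_bound:
  fixes k m s :: nat
  assumes "1 \<le> k" "k \<le> s" "m * k \<le> s"
  shows "(k + 1) * max 2 (1 + m) \<le> 2 * (1 + s)"
proof (cases "m \<le> 1")
  case True then show ?thesis using assms by (cases m) (auto simp: max_def)
next
  case False
  obtain k' m' where "k = Suc k'" "m = Suc m'" using assms(1) False by (metis One_nat_def Suc_le_D nat_le_linear)
  then have "(k + 1) * (1 + m) \<le> 2 * (1 + m * k)"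
    using False by (cases m') (auto simp: algebra_simps)
  also have "\<dots> \<le> 2 * (1 + s)" using assms by simp
  finally show ?thesis using False by (simp add: max_def)
qed

context rooted_tree
begin

text \<open>
  The set \<open>S\<close> consists of the chosen centres \<open>X\<close> and of one vertex from each piece of size \<open>k\<close> that has no
  neighbour in \<open>X\<close>. Such a vertex is adjacent to no other member of \<open>S\<close>, because different pieces are
  not joined by edges. A connected set that avoids the closed neighbourhood of \<open>S\<close> lies in one piece and,
  having at least \<open>k\<close> vertices, would be the whole piece, which \<open>S\<close> meets or touches.
\<close>

lemma ex_small_independent_isolating:
  assumes k: "1 \<le> k" and large: "k < card V"
  obtains S where "S \<subseteq> V" "\<forall>x\<in>S. \<forall>y\<in>S. \<not> adj x y"
    "(k + 1) * card S \<le> card V"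
    "\<forall>H\<subseteq>V. connected_set H \<and> separated S H \<longrightarrow> card H < k"
proof -
  have "up_closed V" using root_in par_in by (auto simp: up_closed_def)
  then obtain Z \<C> \<phi> where cen: "centred k V Z \<C> \<phi>"
    using ex_centred large by blast
  then have ZV: "Z \<subseteq> V" and fC: "finite \<C>" and cover: "\<Union>\<C> = V - Z"
    and sep: "\<And>A B. A \<in> \<C> \<Longrightarrow> B \<in> \<C> \<Longrightarrow> A \<noteq> B \<Longrightarrow> separated A B"
    and small: "\<And>A. A \<in> \<C> \<Longrightarrow> card A \<le> k"
    and \<phi>: "\<And>A. A \<in> \<C> \<Longrightarrow> \<phi> A \<in> Z" "\<And>A. A \<in> \<C> \<Longrightarrow> \<exists>x\<in>A. adj (\<phi> A) x"
    and weight: "\<And>z. z \<in> Z \<Longrightarrow> k \<le> (\<Sum>A | A \<in> \<C> \<and> \<phi> A = z. card A)"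
    unfolding centred_def by (simp_all)
  have fin: "finite Z" "\<And>A. A \<in> \<C> \<Longrightarrow> finite A"
    using ZV cover finite_V by (auto intro: finite_subset)
  define s where "s z = (\<Sum>A | A \<in> \<C> \<and> \<phi> A = z. card A)" for z
  define M where "M z = {A \<in> \<C>. \<phi> A = z \<and> card A = k}" for z
  have fM: "finite (M z)" for z using fC by (simp add: M_def)
  have Mk: "card (M z) * k \<le> s z" for z
  proof -
    have "card (M z) * k = (\<Sum>A\<in>M z. card A)" by (simp add: M_def)
    also have "\<dots> \<le> s z" unfolding s_def using fC by (intro sum_mono2) (auto simp: M_def)
    finally show ?thesis .
  qed
  have total: "(\<Sum>z\<in>Z. 1 + s z) = card V"
  proof -
    have "(\<Sum>z\<in>Z. s z) = (\<Sum>A\<in>\<C>. card A)"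
      unfolding s_def using fC fin \<phi> by (intro sum.group) auto
    also have "\<dots> = card (\<Union>\<C>)"
      using sep fin card_Union_separated[of \<C>] by simp
    also have "\<dots> = card V - card Z" using cover ZV fin by (simp add: card_Diff_subset)
    finally show ?thesis using card_mono[OF finite_V ZV] by (simp add: sum_Suc)
  qed
  obtain X where X: "X \<subseteq> Z" and indep: "\<And>x y. x \<in> X \<Longrightarrow> y \<in> X \<Longrightarrow> \<not> adj x y"
    and dom: "\<And>z. z \<in> Z - X \<Longrightarrow> \<exists>x\<in>X. adj x z"
    and cheap: "2 * (card X + (\<Sum>z\<in>Z - X. card (M z))) \<le> (\<Sum>z\<in>Z. max 2 (1 + card (M z)))"
    using ex_cheap_independent_dominating[OF fin(1), of "\<lambda>z. card (M z)"] by blast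
  define Q where "Q = {A \<in> \<C>. card A = k \<and> (\<forall>x\<in>X. \<forall>y\<in>A. \<not> adj x y)}"
  obtain rep where rep: "\<And>A. A \<in> \<C> \<Longrightarrow> rep A \<in> A" using \<phi>(2) by metis
  define S where "S = X \<union> rep ` Q"
  \<comment> \<open>If the centre a piece is charged to lies in \<open>X\<close>, that centre already hits the piece.\<close>
  have "Q \<subseteq> (\<Union>z\<in>Z - X. M z)"
    using \<phi> by (fastforce simp: Q_def M_def)
  then have "card Q \<le> card (\<Union>z\<in>Z - X. M z)"
    using fin fM by (intro card_mono) auto
  also have "\<dots> \<le> (\<Sum>z\<in>Z - X. card (M z))" using fin by (intro card_UN_le) auto
  finally have cardQ: "card Q \<le> (\<Sum>z\<in>Z - X. card (M z))" .
  have "finite Q" using fC by (simp add: Q_def)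
  then have "card S \<le> card X + card Q"
    unfolding S_def using card_Un_le[of X "rep ` Q"] card_image_le[of Q rep] by linarith
  also have "\<dots> \<le> card X + (\<Sum>z\<in>Z - X. card (M z))" using cardQ by (rule add_left_mono)
  finally have "2 * card S \<le> 2 * (card X + (\<Sum>z\<in>Z - X. card (M z)))" by (rule mult_le_mono2)
  also note cheap
  finally have "2 * card S \<le> (\<Sum>z\<in>Z. max 2 (1 + card (M z)))" .
  then have "(k + 1) * (2 * card S) \<le> (k + 1) * (\<Sum>z\<in>Z. max 2 (1 + card (M z)))"
    by (rule mult_le_mono2)
  also have "\<dots> = (\<Sum>z\<in>Z. (k + 1) * max 2 (1 + card (M z)))" by (rule sum_distrib_left)
  also have "\<dots> \<le> (\<Sum>z\<in>Z. 2 * (1 + s z))"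
    using weight_bound[OF k] weight Mk by (intro sum_mono) (simp add: s_def)
  also have "\<dots> = 2 * card V" using total by (simp only: sum_distrib_left[symmetric])
  finally have bound: "(k + 1) * card S \<le> card V" by simp
  have Q_C: "rep A \<in> A" "A \<in> \<C>" if "A \<in> Q" for A using that rep by (auto simp: Q_def)
  have S_indep: "\<not> adj x y" if xy: "x \<in> S" "y \<in> S" for x y
  proof -
    have "\<not> adj (rep A) (rep B)" if "A \<in> Q" "B \<in> Q" for A B
    proof (cases "A = B")
      case True then show ?thesis using adj_odd_depth[of "rep A" "rep A"] by auto
    next
      case False then show ?thesis
        using sep[of A B] Q_C that by (auto simp: separated_def)
    qed
    moreover have "\<not> adj x (rep A)" "\<not> adj (rep A) x" if "x \<in> X" "A \<in> Q" for x A
      using that Q_C[OF that(2)] adj_sym by (auto simp: Q_def)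
    ultimately show ?thesis using xy indep by (auto simp: S_def)
  qed
  have "card H < k" if H: "H \<subseteq> V" "connected_set H" "separated S H" for H
  proof (rule ccontr)
    assume "\<not> card H < k"
    then have Hk: "k \<le> card H" "H \<noteq> {}" using k by auto
    \<comment> \<open>Every centre lies in \<open>X\<close> or has a neighbour there, so \<open>H\<close> cannot cross from one piece to another.\<close>
    have "H \<inter> Z = {}" using H(3) dom by (fastforce simp: S_def separated_def)
    then have "H \<subseteq> \<Union>\<C>" using H(1) cover by blast
    from connected_set_in_piece[OF H(2) Hk(2) this sep]
    obtain A where A: "A \<in> \<C>" "H \<subseteq> A" by blast
    then have "H = A" and "card A = k"
      using fin(2) small[of A] Hk(1) card_mono[of A H] card_subset_eq[of A H] by auto
    show False
    proof (cases "A \<in> Q")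
      case True
      then have "rep A \<in> S \<inter> H" using Q_C \<open>H = A\<close> by (auto simp: S_def)
      then show False using H(3) by (auto simp: separated_def)
    next
      case False
      then obtain x y where "x \<in> X" "y \<in> A" "adj x y"
        using A \<open>card A = k\<close> by (auto simp: Q_def)
      then show False using H(3) \<open>H = A\<close> by (auto simp: S_def separated_def)
    qed
  qed
  moreover have "S \<subseteq> V" using X ZV Q_C cover by (fastforce simp: S_def)
  ultimately show ?thesis using that[of S] S_indep bound by blast
qed

end

section \<open>Undirected trees as rooted trees\<close>

text \<open>
  In a simple graph a path from \<open>x\<close> to \<open>y\<close> that avoids the edge between them has at least two arcs, so the
  edge closes it to a cycle of length at least three.
\<close>

lemma (in graph) cycle_if_reachable_without_edge:
  assumes xy: "x \<rightarrow> y"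
    and reach: "(x, y) \<in> (arcs_ends G - {(x, y), (y, x)})\<^sup>*"
  shows "\<exists>p. cycle p \<and> 3 \<le> length p"
proof -
  define H where "H = \<lparr>verts = verts G,
    arcs = {a \<in> arcs G. (tail G a, head G a) \<notin> {(x, y), (y, x)}}, tail = tail G, head = head G\<rparr>"
  have H: "wf_digraph H" by unfold_locales (auto simp: H_def)
  interpret H: wf_digraph H by (rule H)
  have sub: "subgraph H G"
    using H by (intro subgraphI) (auto simp: H_def compatible_def wf_digraph)
  have ends: "arcs_ends H = arcs_ends G - {(x, y), (y, x)}"
    by (auto simp: arcs_ends_conv H_def)
  have xV: "x \<in> verts G" "y \<in> verts G" and "x \<noteq> y"
    using xy no_loops by (auto simp: adj_in_verts arcs_ends_conv)
  have "x \<rightarrow>\<^sup>*\<^bsub>H\<^esub> y"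
    using reach
  proof (induction rule: rtrancl_induct)
    case base
    show ?case using xV by (intro H.reachable_refl) (simp add: H_def)
  next
    case (step b c)
    then show ?case using ends H.reachable_adj_trans by blast
  qed
  then obtain p where p: "H.apath x p y" using H.reachable_apath by blast
  then have pG: "apath x p y" using sub subgraph_apath_imp_apath by blast
  have pH: "set p \<subseteq> arcs H" using p by (auto simp: H.apath_def H.awalk_def)
  obtain a where a: "a \<in> arcs G" "tail G a = y" "head G a = x"
    using graph_symmetric[OF xy] by (auto simp: arcs_ends_conv)
  have walk: "awalk x (p @ [a]) x"
    using pG a xV by (auto simp: apath_def awalk_simps awalk_def)
  have ne: "p \<noteq> []" using pG \<open>x \<noteq> y\<close> by (auto simp: apath_def awalk_def)
  \<comment> \<open>A single arc would join \<open>x\<close> to \<open>y\<close>, and \<open>H\<close> has no such arc.\<close>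
  have "p \<noteq> [b]" for b
    using pG pH by (auto simp: apath_def awalk_def H_def)
  with ne have len: "2 \<le> length p" by (cases p; cases "tl p") auto
  have vs: "awalk_verts x (p @ [a]) = awalk_verts x p @ [x]"
    using awalk_verts_append[OF walk] a by simp
  have hd: "hd (awalk_verts x p) = x" using pG by (auto simp: apath_def awalk_def elim: awhd_of_awalk)
  have dist: "distinct (awalk_verts x p)" using pG by (simp add: apath_def)
  obtain vs' where vs': "awalk_verts x p = x # vs'"
    using hd awalk_verts_non_Nil[of x p] by (metis list.collapse)
  have "distinct (tl (awalk_verts x (p @ [a])))"
    using vs vs' dist by simp
  then show ?thesis using walk len by (intro exI[of _ "p @ [a]"]) (auto simp: cycle_def)
qed

text \<open>
  The parent of a vertex is a neighbour that is closer to a fixed root. Every vertex reaches the root along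
  parent edges, so any further edge would close a cycle.
\<close>

lemma undirected_tree_rooted:
  assumes T: "undirected_tree T"
  obtains r par depth where "rooted_tree (verts T) r par depth"
    "\<And>x y. x \<rightarrow>\<^bsub>T\<^esub> y \<longleftrightarrow> rooted_tree.adj (verts T) r par x y"
proof -
  interpret graph T using T by (simp add: undirected_tree_def)
  have "strongly_connected T"
    using T symmetric_connected_imp_strongly_connected sym_arcs
    by (auto simp: undirected_tree_def)
  then obtain r where r: "r \<in> verts T" and reach: "\<And>x. x \<in> verts T \<Longrightarrow> r \<rightarrow>\<^sup>*\<^bsub>T\<^esub> x"
    by (auto simp: strongly_connected_def)
  let ?E = "arcs_ends T"
  define depth where "depth x = (LEAST n. (r, x) \<in> ?E ^^ n)" for x
  have depth_le: "depth x \<le> n" if "(r, x) \<in> ?E ^^ n" for x n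
    unfolding depth_def using that by (rule Least_le)
  have depth: "(r, x) \<in> ?E ^^ depth x" if "x \<in> verts T" for x
  proof -
    have "(r, x) \<in> ?E\<^sup>*" using reach[OF that] by (rule reachable_rtranclI)
    then show ?thesis unfolding depth_def using rtrancl_imp_relpow LeastI_ex by metis
  qed
  have "\<exists>y. y \<rightarrow>\<^bsub>T\<^esub> x \<and> depth x = Suc (depth y)" if x: "x \<in> verts T" "x \<noteq> r" for x
  proof -
    obtain n where n: "depth x = Suc n"
      using depth[OF x(1)] x(2) by (cases "depth x") auto
    then obtain y where y: "(r, y) \<in> ?E ^^ n" "y \<rightarrow>\<^bsub>T\<^esub> x"
      using depth[OF x(1)] by auto
    have "y \<in> verts T" using y by (simp add: adj_in_verts)
    then have "depth x \<le> Suc (depth y)" using depth_le[of x "Suc (depth y)"] depth y by auto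
    then show ?thesis using y n depth_le[OF y(1)] by (intro exI[of _ y]) auto
  qed
  then obtain par where par: "\<And>x. x \<in> verts T \<Longrightarrow> x \<noteq> r \<Longrightarrow> par x \<rightarrow>\<^bsub>T\<^esub> x \<and> depth x = Suc (depth (par x))"
    by metis
  have rt: "rooted_tree (verts T) r par depth"
    using r par by unfold_locales (auto dest: adj_in_verts)
  interpret R: rooted_tree "verts T" r par depth by (rule rt)
  have "x \<rightarrow>\<^bsub>T\<^esub> y \<longleftrightarrow> R.adj x y" for x y
  proof
    assume "R.adj x y"
    then show "x \<rightarrow>\<^bsub>T\<^esub> y" using par graph_symmetric by (auto simp: R.adj_def R.up_def)
  next
    assume xy: "x \<rightarrow>\<^bsub>T\<^esub> y"
    show "R.adj x y"
    proof (rule ccontr)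
      assume no: "\<not> R.adj x y"
      define E' where "E' = ?E - {(x, y), (y, x)}"
      have up: "R.up \<subseteq> E'"
        using par graph_symmetric no by (auto simp: E'_def R.adj_def R.up_def)
      have "sym E'" using graph_symmetric by (auto simp: E'_def sym_def)
      have "(z, r) \<in> E'\<^sup>*" if "z \<in> verts T" for z
        using R.desc_root[OF that] rtrancl_mono[OF up] by (auto simp: R.desc_def)
      moreover have "x \<in> verts T" "y \<in> verts T" using xy by (auto simp: adj_in_verts)
      ultimately have "(x, y) \<in> E'\<^sup>*"
        using \<open>sym E'\<close> by (meson rtrancl_trans sym_rtrancl symD)
      then show False
        using cycle_if_reachable_without_edge[OF xy] T
        by (auto simp: undirected_tree_def E'_def)
    qed
  qed
  with rt that show ?thesis by blast
qed

section \<open>The bound\<close>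

theorem theorem1:
  fixes T :: "('a, 'b) pre_digraph" and k :: nat
  assumes "k \<ge> 1"
    and "undirected_tree T"
    and "card (verts T) \<noteq> k"
  shows "all_isolation_number k T \<le> indep_all_isolation_number k T
    \<and> real (indep_all_isolation_number k T) \<le> real (card (verts T)) / (real k + 1)"
proof
  interpret graph T using assms(2) by (simp add: undirected_tree_def)
  have "\<exists>m S. all_isolating k T S \<and> independent_set T S \<and> card S = m"
    using ex_independent_all_isolating[of T k] assms(2) by (auto simp: undirected_tree_def)
  then have "\<exists>S. all_isolating k T S \<and> independent_set T S
      \<and> card S = indep_all_isolation_number k T"
    unfolding indep_all_isolation_number_def by (rule LeastI_ex)
  then show "all_isolation_number k T \<le> indep_all_isolation_number k T"
    unfolding all_isolation_number_def by (intro Least_le) blast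
  have "\<exists>S. all_isolating k T S \<and> independent_set T S \<and> (k + 1) * card S \<le> card (verts T)"
  proof (cases "card (verts T) < k")
    case True
    have "card (verts H) < k" if "H \<in> pre_digraph.sccs (T \<restriction> (verts T - closed_nbhd T {}))" for H
    proof -
      have "verts H \<subseteq> verts T"
        using that by (auto simp: pre_digraph.sccs_def induced_subgraph_def subgraph_def)
      then show ?thesis using True card_mono[of "verts T" "verts H"] by simp
    qed
    then have "all_isolating k T {}" by (auto simp: all_isolating_def not_le)
    then show ?thesis by (intro exI[of _ "{}"]) (simp add: independent_set_def)
  next
    case False
    then have large: "k < card (verts T)" using assms(3) by simp
    obtain r par depth where R: "rooted_tree (verts T) r par depth"
      and adj: "\<And>x y. x \<rightarrow>\<^bsub>T\<^esub> y \<longleftrightarrow> rooted_tree.adj (verts T) r par x y"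
      using undirected_tree_rooted[OF assms(2)] by blast
    interpret R: rooted_tree "verts T" r par depth by (rule R)
    obtain S where S: "S \<subseteq> verts T" "\<forall>x\<in>S. \<forall>y\<in>S. \<not> R.adj x y"
      "(k + 1) * card S \<le> card (verts T)"
      and iso: "\<forall>H\<subseteq>verts T. R.connected_set H \<and> R.separated S H \<longrightarrow> card H < k"
      by (rule R.ex_small_independent_isolating[OF assms(1) large])
    have "card (verts H) < k" if "H \<in> pre_digraph.sccs (T \<restriction> (verts T - closed_nbhd T S))" for H
    proof -
      let ?G = "T \<restriction> (verts T - closed_nbhd T S)"
      have sub: "subgraph H ?G" and sc: "strongly_connected H"
        using that by (auto simp: pre_digraph.sccs_def induced_subgraph_def)
      then have H: "verts H \<subseteq> verts T - closed_nbhd T S" by (auto simp: subgraph_def)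
      interpret H: wf_digraph H using sub by (simp add: subgraph_def)
      have "R.separated S (verts H)"
        using H by (auto simp: closed_nbhd_def R.separated_def adj[symmetric])
      moreover have "arcs_ends H \<subseteq> {(a, b). R.adj a b \<and> a \<in> verts H \<and> b \<in> verts H}"
        using arcs_ends_mono[OF sub] H.adj_in_verts
        by (auto simp: adj[symmetric] dest: dominates_induce_subgraphD)
      then have "(arcs_ends H)\<^sup>* \<subseteq> {(a, b). R.adj a b \<and> a \<in> verts H \<and> b \<in> verts H}\<^sup>*"
        by (rule rtrancl_mono)
      then have "R.connected_set (verts H)"
        using sc reachable_rtranclI[where G = H]
        unfolding R.connected_set_def strongly_connected_def by (meson subsetD)
      ultimately show ?thesis using iso H by blast
    qed
    then have "all_isolating k T S" using S(1) by (auto simp: all_isolating_def not_le)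
    moreover have "independent_set T S" using S(1,2) adj by (auto simp: independent_set_def)
    ultimately show ?thesis using S(3) by blast
  qed
  then obtain S where S: "all_isolating k T S" "independent_set T S"
    "(k + 1) * card S \<le> card (verts T)" by blast
  have "indep_all_isolation_number k T \<le> card S"
    unfolding indep_all_isolation_number_def using S by (intro Least_le) blast
  then have "(k + 1) * indep_all_isolation_number k T \<le> card (verts T)"
    using S(3) by (meson le_trans mult_le_mono2)
  then have "(real k + 1) * real (indep_all_isolation_number k T) \<le> real (card (verts T))"
    by (metis of_nat_1 of_nat_add of_nat_le_iff of_nat_mult)
  then show "real (indep_all_isolation_number k T) \<le> real (card (verts T)) / (real k + 1)"
    by (simp add: pos_le_divide_eq mult.commute)
qed

end
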